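(* Let $H$ be a countable subgroup of $\mathbb{T}$ and let $m_1<m_2<\ldots$ be an (arbitrarily fast) increasing sequence of positive integers. Then there is a characterizing sequence $k_1<k_2<\ldots$ of integers for $H$ with $m_n<k_n$ for all $n\ge 1$.
   Context: $\mathbb{T}=\mathbb{R}/\mathbb{Z}$, written additively. Subgroups of $\mathbb{T}$ need not be closed. A sequence $(k_n)_{n=1}^\infty$ of integers is characterizing for the subgroup $H\le\mathbb{T}$ if for all $\alpha\in\mathbb{T}$: $\alpha\in H\iff\lim_{n\to\infty}k_n\alpha=0$ in $\mathbb{T}$. *)

theory Defs
  imports Complex_Main "HOL-Library.Countable_Set"
begin

quotient_type circle = real / "\<lambda>x y::real. x - y \<in> \<int>"
  morphisms rep_circle circle_of_real
proof (rule equivpI)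
  show "reflp (\<lambda>x y::real. x - y \<in> \<int>)"
    by (simp add: reflp_def)
  show "symp (\<lambda>x y::real. x - y \<in> \<int>)"
    by (rule sympI) (metis Ints_minus minus_diff_eq)
  show "transp (\<lambda>x y::real. x - y \<in> \<int>)"
  proof (rule transpI)
    fix x y z :: real
    assume "x - y \<in> \<int>" "y - z \<in> \<int>"
    then have "(x - y) + (y - z) \<in> \<int>" by (rule Ints_add)
    then show "x - z \<in> \<int>" by simp
  qed
qed

instantiation circle :: ab_group_add
begin

lift_definition zero_circle :: circle is "0 :: real" .

lift_definition plus_circle :: "circle \<Rightarrow> circle \<Rightarrow> circle" is "(+) :: real \<Rightarrow> real \<Rightarrow> real"
proof -
  fix a b c d :: real
  assume "a - b \<in> \<int>" "c - d \<in> \<int>"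
  then have "(a - b) + (c - d) \<in> \<int>" by (rule Ints_add)
  then show "(a + c) - (b + d) \<in> \<int>" by (simp add: algebra_simps)
qed

lift_definition uminus_circle :: "circle \<Rightarrow> circle" is "uminus :: real \<Rightarrow> real"
proof -
  fix a b :: real
  assume "a - b \<in> \<int>"
  then have "- (a - b) \<in> \<int>" by (rule Ints_minus)
  then show "- a - - b \<in> \<int>" by simp
qed

lift_definition minus_circle :: "circle \<Rightarrow> circle \<Rightarrow> circle" is "(-) :: real \<Rightarrow> real \<Rightarrow> real"
proof -
  fix a b c d :: real
  assume "a - b \<in> \<int>" "c - d \<in> \<int>"
  then have "(a - b) - (c - d) \<in> \<int>" by (rule Ints_diff)
  then show "(a - c) - (b - d) \<in> \<int>" by (simp add: algebra_simps)
qed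

instance
  by standard (transfer; simp)+

end

text \<open>The quotient topology on \<open>\<real>/\<int>\<close>.\<close>

instantiation circle :: topological_space
begin

definition open_circle :: "circle set \<Rightarrow> bool" where
  "open U \<longleftrightarrow> open (circle_of_real -` U)"

instance
  by standard (auto simp: open_circle_def vimage_Union intro: open_Int open_UN)

end

lift_definition int_mult :: "int \<Rightarrow> circle \<Rightarrow> circle" is "\<lambda>k x. real_of_int k * x"
  by (simp flip: right_diff_distrib)

text \<open>\<^const>\<open>int_mult\<close> is the usual multiple in the abelian group \<open>\<real>/\<int>\<close>.\<close>

lemma int_mult_zero: "int_mult 0 a = 0"
  by transfer simp

lemma int_mult_add_one: "int_mult (k + 1) a = int_mult k a + a"
  by transfer (simp add: distrib_right)

definition add_subgroup :: "circle set \<Rightarrow> bool" where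
  "add_subgroup H \<longleftrightarrow> 0 \<in> H \<and> (\<forall>a\<in>H. \<forall>b\<in>H. a + b \<in> H) \<and> (\<forall>a\<in>H. - a \<in> H)"

text \<open>Sequences are indexed by \<open>n \<ge> 1\<close>; the value \<open>k 0\<close> is irrelevant.\<close>

definition characterizing :: "(nat \<Rightarrow> int) \<Rightarrow> circle set \<Rightarrow> bool" where
  "characterizing k H \<longleftrightarrow> (\<forall>a. a \<in> H \<longleftrightarrow> (\<lambda>n. int_mult (k n) a) \<longlonglongrightarrow> 0)"

end

theory Submission
  imports Defs "HOL-Analysis.Complex_Transcendental" "HOL-Library.Real_Mod"
begin

text \<open>Embed the circle into \<open>\<complex>\<close> and enumerate the countable subgroup as \<open>z\<^sub>0, z\<^sub>1, \<dots>\<close>. Let \<open>B n\<close> be the Bohr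
  set of those \<open>k\<close> for which \<open>z\<^sub>i ^ k\<close> is within \<open>1 / (n + 1)\<close> of 1 for all \<open>i \<le> n\<close>, and let \<open>K n\<close> be its
  polar, the set of \<open>w\<close> on the circle with \<open>|w ^ k - 1| \<le> 1/2\<close> for \<open>k \<in> B n\<close>. Averaging against a
  trigonometric weight concentrated on \<open>B n\<close> shows that \<open>K n\<close> is contained in the subgroup, and
  since \<open>B n\<close> has bounded gaps, \<open>K n\<close> is uniformly discrete, hence finite. By compactness
  finite blocks \<open>A n \<subseteq> B n\<close> can be chosen so that a point in the polars of all but finitely many
  \<open>A n\<close> stays close to one fixed point of the \<open>K n\<close>, hence equals it. Enumerating the blocks gives
  a characterizing sequence \<open>a\<^sub>j\<close>. Finally, with \<open>N\<^sub>j \<in> B j\<close> growing as fast as desired, the interleaved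
  sequence \<open>N\<^sub>j, N\<^sub>j + a\<^sub>j\<close> is characterizing as well.\<close>

section \<open>Bohr sets and their polars: bounded gaps, finiteness, trigonometric averages\<close>

definition bohr_set :: "complex set \<Rightarrow> real \<Rightarrow> nat set" where
  "bohr_set F e = {k. \<forall>z\<in>F. cmod (z ^ k - 1) \<le> e}"

text \<open>The bound 1/2 does two jobs: it keeps \<open>Re (w ^ k)\<close> at least 1/2 for
  \<open>k\<close> in \<open>A\<close>, and the quotient of two points of the polar still has its
  \<open>k\<close>-th powers within 1 of 1.\<close>

definition power_polar :: "nat set \<Rightarrow> complex set" where
  "power_polar A = {w. cmod w = 1 \<and> (\<forall>k\<in>A. cmod (w ^ k - 1) \<le> 1/2)}"

lemma cmod_diff_one_sq:
  assumes "cmod z = 1"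
  shows "(cmod (z - 1))\<^sup>2 = 2 - 2 * Re z"
proof -
  have "(Re z)\<^sup>2 + (Im z)\<^sup>2 = 1" using assms by (simp flip: cmod_power2)
  then show ?thesis unfolding cmod_power2 by (simp add: power2_eq_square algebra_simps)
qed

lemma bounded_geometric_sums:
  fixes w :: complex
  assumes "cmod w = 1" "w \<noteq> 1"
  shows "cmod (\<Sum>k<N. w ^ k) \<le> 2 / cmod (w - 1)"
proof -
  have "(\<Sum>k<N. w ^ k) = (w ^ N - 1) / (w - 1)"
    using assms(2) by (simp add: geometric_sum)
  moreover have "cmod (w ^ N - 1) \<le> 2"
    using norm_triangle_ineq4[of "w ^ N" 1] assms(1) by (simp add: norm_power)
  ultimately show ?thesis by (simp add: norm_divide divide_right_mono)
qed

text \<open>If all powers stayed within 6/5 of 1, their real parts would be at least 1/4 and their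
  sum would grow linearly, against the bound for geometric sums. Any constant below the square root
  of 2 would do; 6/5 leaves room above 1 + 1/10.\<close>

lemma exists_power_far_from_one:
  assumes "cmod w = 1" "w \<noteq> 1"
  shows "\<exists>k. cmod (w ^ k - 1) > 6/5"
proof (rule ccontr)
  assume "\<nexists>k. cmod (w ^ k - 1) > 6/5"
  then have "cmod (w ^ k - 1) \<le> 6/5" for k by (simp add: not_less)
  then have "(cmod (w ^ k - 1))\<^sup>2 \<le> (6/5)\<^sup>2" for k by (intro power_mono) auto
  then have sq: "(cmod (w ^ k - 1))\<^sup>2 \<le> 36/25" for k by (simp add: power_divide)
  have *: "Re (w ^ k) \<ge> 1/4" for k
    using sq[of k] cmod_diff_one_sq[of "w ^ k"] assms(1) by (simp add: norm_power)
  obtain N where N: "real N * (1/4) > 2 / cmod (w - 1)"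
    using reals_Archimedean2[of "8 / cmod (w - 1)"] by auto
  have "real N * (1/4) \<le> (\<Sum>k<N. Re (w ^ k))"
    using sum_mono[of "{..<N}" "\<lambda>_. 1/4" "\<lambda>k. Re (w ^ k)"] * by simp
  also have "\<dots> = Re (\<Sum>k<N. w ^ k)" by simp
  also have "\<dots> \<le> cmod (\<Sum>k<N. w ^ k)" by (rule complex_Re_le_cmod)
  also have "\<dots> \<le> 2 / cmod (w - 1)" by (rule bounded_geometric_sums[OF assms])
  finally show False using N by simp
qed

text \<open>Pigeonhole: colour each exponent by the cells of a finite cover of the circle that
  contain the powers of the points of \<open>F\<close>. Two exponents of the same colour differ by
  an element of the Bohr set, and each colour has a representative below a common bound
  \<open>R\<close>.\<close>

lemma bohr_set_syndetic:
  assumes "finite F" "\<And>z. z \<in> F \<Longrightarrow> cmod z = 1" "e > 0"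
  shows "\<exists>L. \<forall>k. \<exists>b\<in>bohr_set F e. k < b \<and> b < k + L"
proof -
  obtain C where C: "finite C" "sphere (0::complex) 1 \<subseteq> (\<Union>c\<in>C. ball c (e/2))"
    by (rule compactE_image[of "sphere (0::complex) 1" "sphere 0 1" "\<lambda>c. ball c (e/2)"])
      (use assms(3) in auto)
  then have "\<forall>u. cmod u = 1 \<longrightarrow> (\<exists>c\<in>C. dist c u < e/2)" by (auto simp: subset_eq)
  then obtain center where center: "\<And>u. cmod u = 1 \<Longrightarrow> center u \<in> C \<and> dist (center u) u < e/2"
    by metis
  define cell where "cell k = restrict (\<lambda>z. center (z ^ k)) F" for k :: nat
  have "range cell \<subseteq> F \<rightarrow>\<^sub>E C"
    using center assms(2) by (auto simp: cell_def norm_power)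
  then have fin: "finite (range cell)"
    using finite_subset finite_PiE[of F "\<lambda>_. C"] assms(1) C(1) by blast
  define R where "R = Max (inv cell ` range cell)"
  have "\<exists>b\<in>bohr_set F e. k < b \<and> b < k + (R + 2)" for k
  proof -
    \<comment> \<open>As \<open>r\<close> is at most \<open>R\<close>, the difference
      \<open>k' - r\<close> lies strictly between \<open>k\<close> and
      \<open>k + R + 2\<close>.\<close>
    define k' where "k' = k + R + 1"
    define r where "r = inv cell (cell k')"
    have r: "cell r = cell k'" unfolding r_def by (simp add: f_inv_into_f)
    have "r \<le> R" unfolding R_def r_def using fin by (intro Max_ge) auto
    have "cmod (z ^ (k' - r) - 1) \<le> e" if "z \<in> F" for z
    proof -
      have z: "cmod z = 1" using that assms(2) by blast
      have "center (z ^ r) = center (z ^ k')"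
        using r that by (metis cell_def restrict_apply')
      then have "dist (z ^ k') (z ^ r) < e"
        using center[of "z ^ r"] center[of "z ^ k'"] z
        by (metis dist_commute dist_triangle_half_l norm_power power_one)
      moreover have "z ^ k' - z ^ r = (z ^ (k' - r) - 1) * z ^ r"
        using \<open>r \<le> R\<close> by (simp add: k'_def left_diff_distrib flip: power_add)
      ultimately show ?thesis using z by (simp add: dist_norm norm_mult norm_power)
    qed
    then have "k' - r \<in> bohr_set F e" by (simp add: bohr_set_def)
    then show ?thesis using \<open>r \<le> R\<close> by (intro bexI[of _ "k' - r"]) (auto simp: k'_def)
  qed
  then show ?thesis by blast
qed

text \<open>The powers of \<open>w = x / y\<close> at exponents in the Bohr set are within 1 of 1.
  Every exponent is followed within \<open>L\<close> steps by such an exponent, so if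
  \<open>w\<close> is very close to 1, all its powers are within 1 + 1/10 of 1. This is below 6/5
  and forces \<open>w = 1\<close>.\<close>

lemma power_polar_bohr_set_separated:
  assumes "finite F" "\<And>z. z \<in> F \<Longrightarrow> cmod z = 1" "e > 0"
  shows "\<exists>d>0. \<forall>x\<in>power_polar (bohr_set F e). \<forall>y\<in>power_polar (bohr_set F e).
           dist x y < d \<longrightarrow> x = y"
proof -
  obtain L where L: "\<And>k. \<exists>b\<in>bohr_set F e. k < b \<and> b < k + L"
    using bohr_set_syndetic[OF assms] by blast
  then have "L > 0" by (metis add_0 gr0I not_less0 add_0_right less_asym)
  show ?thesis
  proof (intro exI[of _ "1 / (10 * real L)"] conjI ballI impI)
    show "1 / (10 * real L) > 0" using \<open>L > 0\<close> by simp
  next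
    fix x y
    assume x: "x \<in> power_polar (bohr_set F e)" and y: "y \<in> power_polar (bohr_set F e)"
      and d: "dist x y < 1 / (10 * real L)"
    have [simp]: "cmod x = 1" "cmod y = 1" using x y by (auto simp: power_polar_def)
    then have [simp]: "y \<noteq> 0" by (metis norm_zero zero_neq_one)
    define w where "w = x / y"
    have w1: "cmod w = 1" by (simp add: w_def norm_divide)
    have "w - 1 = (x - y) / y" by (simp add: w_def diff_divide_distrib)
    then have wd: "cmod (w - 1) < 1 / (10 * real L)"
      using d by (simp add: norm_divide dist_norm)
    show "x = y"
    proof (rule ccontr)
      assume "x \<noteq> y"
      then have "w \<noteq> 1" by (simp add: w_def)
      then obtain k where k: "cmod (w ^ k - 1) > 6/5" using exists_power_far_from_one w1 by blast
      obtain b where b: "b \<in> bohr_set F e" "k < b" "b < k + L" using L by blast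
      have "w ^ b - w ^ k = (w ^ (b - k) - 1) * w ^ k"
        using b by (simp add: left_diff_distrib flip: power_add)
      then have "cmod (w ^ b - w ^ k) = cmod (w ^ (b - k) - 1 ^ (b - k))"
        by (simp add: norm_mult norm_power w1)
      also have "\<dots> \<le> real (b - k) * cmod (w - 1)"
        by (rule norm_power_diff) (auto simp: w1)
      also have "\<dots> \<le> real L * (1 / (10 * real L))"
        using wd b by (intro mult_mono) auto
      also have "\<dots> = 1/10" using \<open>L > 0\<close> by simp
      finally have 1: "cmod (w ^ b - w ^ k) \<le> 1/10" .
      have "w ^ b - 1 = ((x ^ b - 1) - (y ^ b - 1)) / y ^ b"
        by (simp add: w_def power_divide diff_divide_distrib)
      then have "cmod (w ^ b - 1) = cmod ((x ^ b - 1) - (y ^ b - 1))"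
        by (simp add: norm_divide norm_power)
      also have "\<dots> \<le> cmod (x ^ b - 1) + cmod (y ^ b - 1)" by (rule norm_triangle_ineq4)
      also have "\<dots> \<le> 1/2 + 1/2" using x y b by (intro add_mono) (auto simp: power_polar_def)
      finally show False using 1 k norm_triangle_ineq4[of "w ^ b - 1" "w ^ b - w ^ k"] by simp
    qed
  qed
qed

text \<open>A uniformly separated set is closed; being bounded as well, it is covered by finitely
  many balls of radius \<open>d\<close>, each holding one point.\<close>

lemma finite_power_polar_bohr_set:
  assumes "finite F" "\<And>z. z \<in> F \<Longrightarrow> cmod z = 1" "e > 0"
  shows "finite (power_polar (bohr_set F e))"
proof -
  let ?K = "power_polar (bohr_set F e)"
  obtain d where d: "d > 0" "\<And>x y. x \<in> ?K \<Longrightarrow> y \<in> ?K \<Longrightarrow> dist x y < d \<Longrightarrow> x = y"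
    using power_polar_bohr_set_separated[OF assms] by blast
  have "closed ?K" using d discrete_imp_closed[of d ?K] by (metis dist_commute)
  moreover have "bounded ?K" by (auto simp: power_polar_def bounded_iff intro!: exI[of _ 1])
  ultimately have "compact ?K" by (simp add: compact_eq_bounded_closed)
  then obtain C where C: "C \<subseteq> ?K" "finite C" "?K \<subseteq> (\<Union>c\<in>C. ball c d)"
    by (rule compactE_image[of ?K ?K "\<lambda>c. ball c d"]) (use \<open>compact ?K\<close> d(1) in auto)
  then have "?K \<subseteq> C" using d(2) by fastforce
  then show ?thesis using C finite_subset by blast
qed

text \<open>The weight \<open>f\<close> is a trigonometric polynomial with frequencies in \<open>Z\<close>, so multiplying by it
  keeps the sums against every character outside \<open>Z\<close> bounded.\<close>

lemma bounded_weighted_power_sums: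
  fixes Z F :: "complex set"
  defines "f \<equiv> \<lambda>k. (\<Sum>z\<in>F. (1 + Re (z ^ k)) / 2) / real (card F)"
  assumes Z: "1 \<in> Z" "\<And>x y. x \<in> Z \<Longrightarrow> y \<in> Z \<Longrightarrow> x * y \<in> Z" "\<And>x. x \<in> Z \<Longrightarrow> inverse x \<in> Z"
    and unit: "\<And>x. x \<in> Z \<Longrightarrow> cmod x = 1"
    and F: "finite F" "F \<subseteq> Z"
    and w: "cmod w = 1" "w \<notin> Z"
  shows "\<exists>C. \<forall>N. cmod (\<Sum>k<N. of_real (f k) ^ M * w ^ k) \<le> C"
  using w
proof (induction M arbitrary: w)
  case 0
  then have "w \<noteq> 1" using Z(1) by blast
  then show ?case using bounded_geometric_sums[OF 0(1)] by auto
next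
  case (Suc M)
  define S where "S v N = (\<Sum>k<N. of_real (f k) ^ M * v ^ k)" for v :: complex and N :: nat
  \<comment> \<open>Multiplying \<open>w\<close> by an element of the group stays outside
    \<open>Z\<close>, so the induction hypothesis applies to every shifted character.\<close>
  have shift: "\<exists>C. \<forall>N. cmod (S (v * w) N) \<le> C" if "v \<in> Z" for v
  proof -
    have "v * w \<notin> Z"
    proof
      assume "v * w \<in> Z"
      then have "inverse v * (v * w) \<in> Z" using Z that by blast
      moreover have "v \<noteq> 0" using unit that by force
      ultimately show False using Suc.prems by (simp flip: mult.assoc)
    qed
    then show ?thesis using Suc.IH[of "v * w"] Suc.prems unit[OF that]
      unfolding S_def by (simp add: norm_mult)
  qed
  have "\<forall>v. \<exists>C. v \<in> Z \<longrightarrow> (\<forall>N. cmod (S (v * w) N) \<le> C)" using shift by blast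
  then obtain C where C: "\<And>v N. v \<in> Z \<Longrightarrow> cmod (S (v * w) N) \<le> C v" by metis
  have fk: "of_real (f k) = (\<Sum>z\<in>F. (2 + z ^ k + inverse z ^ k) / 4) / of_nat (card F)" for k
  proof -
    have "complex_of_real ((1 + Re (z ^ k)) / 2) = (2 + z ^ k + inverse z ^ k) / 4"
      if "z \<in> F" for z
    proof -
      have "z * cnj z = 1" using unit that F by (auto simp: complex_norm_square[symmetric])
      then have "inverse z = cnj z" by (rule inverse_unique)
      then have "inverse z ^ k = cnj (z ^ k)" by simp
      then show ?thesis using complex_add_cnj[of "z ^ k"] by (simp add: complex_eq_iff)
    qed
    then have "(\<Sum>z\<in>F. complex_of_real ((1 + Re (z ^ k)) / 2)) = (\<Sum>z\<in>F. (2 + z ^ k + inverse z ^ k) / 4)"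
      by (intro sum.cong) auto
    then show ?thesis by (simp add: f_def)
  qed
  have eq: "(\<Sum>k<N. of_real (f k) ^ Suc M * w ^ k)
      = (\<Sum>z\<in>F. (2 * S (1 * w) N + S (z * w) N + S (inverse z * w) N) / 4) / of_nat (card F)" for N
  proof -
    have "of_real (f k) ^ Suc M * w ^ k =
        (\<Sum>z\<in>F. (2 + z ^ k + inverse z ^ k) / 4 / of_nat (card F) * (of_real (f k) ^ M * w ^ k))" for k
      unfolding power_Suc mult.assoc sum_distrib_right[symmetric]
      unfolding fk[of k] sum_divide_distrib by simp
    then have "(\<Sum>k<N. of_real (f k) ^ Suc M * w ^ k) =
       (\<Sum>k<N. \<Sum>z\<in>F. (2 + z ^ k + inverse z ^ k) / 4 / of_nat (card F) * (of_real (f k) ^ M * w ^ k))"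
      by simp
    also have "\<dots> = (\<Sum>z\<in>F. \<Sum>k<N. (2 + z ^ k + inverse z ^ k) / 4 / of_nat (card F) * (of_real (f k) ^ M * w ^ k))"
      by (rule sum.swap)
    also have "\<dots> = (\<Sum>z\<in>F. (2 * S (1 * w) N + S (z * w) N + S (inverse z * w) N) / 4 / of_nat (card F))"
      unfolding S_def sum_distrib_left sum.distrib[symmetric] sum_divide_distrib
      by (intro sum.cong refl) (simp add: power_mult_distrib field_simps)
    finally show ?thesis by (simp add: sum_divide_distrib)
  qed
  have "cmod (\<Sum>k<N. of_real (f k) ^ Suc M * w ^ k)
      \<le> (\<Sum>z\<in>F. (2 * C 1 + C z + C (inverse z)) / 4) / real (card F)" for N
  proof -
    have "cmod ((2 * S (1 * w) N + S (z * w) N + S (inverse z * w) N) / 4)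
        \<le> (2 * C 1 + C z + C (inverse z)) / 4" if "z \<in> F" for z
    proof -
      have "z \<in> Z" "inverse z \<in> Z" using that F Z by auto
      then have "cmod (2 * S (1 * w) N) \<le> 2 * C 1" "cmod (S (z * w) N) \<le> C z"
        "cmod (S (inverse z * w) N) \<le> C (inverse z)"
        using C[OF Z(1)] C by (auto simp: norm_mult)
      then show ?thesis
        using norm_triangle_ineq[of "2 * S (1 * w) N + S (z * w) N" "S (inverse z * w) N"]
          norm_triangle_ineq[of "2 * S (1 * w) N" "S (z * w) N"]
        by (simp add: norm_divide)
    qed
    then show ?thesis unfolding eq norm_divide norm_of_nat
      by (intro divide_right_mono sum_norm_le) auto
  qed
  then show ?case by blast
qed

text \<open>Averaging \<open>f ^ M\<close> against \<open>w ^ k\<close>: for large \<open>M\<close> the weight concentrates on the Bohr set, where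
  \<open>w ^ k\<close> is close to 1, so the sums grow linearly unless \<open>w \<in> Z\<close>.\<close>

lemma power_polar_bohr_set_subset:
  fixes Z F :: "complex set"
  assumes Z: "1 \<in> Z" "\<And>x y. x \<in> Z \<Longrightarrow> y \<in> Z \<Longrightarrow> x * y \<in> Z" "\<And>x. x \<in> Z \<Longrightarrow> inverse x \<in> Z"
    and unit: "\<And>x. x \<in> Z \<Longrightarrow> cmod x = 1"
    and F: "finite F" "F \<subseteq> Z" "F \<noteq> {}"
    and e: "0 < e" "e \<le> 1"
  shows "power_polar (bohr_set F e) \<subseteq> Z"
proof (rule subsetI, rule ccontr)
  fix w assume wp: "w \<in> power_polar (bohr_set F e)" and wZ: "w \<notin> Z"
  have w1: "cmod w = 1" using wp by (simp add: power_polar_def)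
  define r where "r = real (card F)"
  have r: "r \<ge> 1" using F by (simp add: r_def Suc_leI card_gt_0_iff)
  define f where "f k = (\<Sum>z\<in>F. (1 + Re (z ^ k)) / 2) / r" for k
  have unitF: "cmod (z ^ k) = 1" if "z \<in> F" for z k using that F unit by (auto simp: norm_power)
  have f_eq: "f k = 1 - (\<Sum>z\<in>F. (cmod (z ^ k - 1))\<^sup>2) / (4 * r)" for k
  proof -
    have "(1 + Re (z ^ k)) / 2 = 1 - (cmod (z ^ k - 1))\<^sup>2 / 4" if "z \<in> F" for z
      using cmod_diff_one_sq[OF unitF[OF that, of k]] by (simp add: field_simps)
    then have "f k = (\<Sum>z\<in>F. 1 - (cmod (z ^ k - 1))\<^sup>2 / 4) / r"
      unfolding f_def by (simp only: cong: sum.cong)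
    then show ?thesis using r
      by (simp add: sum_subtractf r_def[symmetric] diff_divide_distrib flip: sum_divide_distrib)
  qed
  have f0: "f k \<ge> 0" for k
  proof -
    have "Re (z ^ k) \<ge> -1" if "z \<in> F" for z
      using abs_Re_le_cmod[of "z ^ k"] unitF[OF that, of k] by simp
    then show ?thesis unfolding f_def using r by (intro divide_nonneg_nonneg sum_nonneg) force+
  qed
  \<comment> \<open>\<open>\<rho>\<close> bounds \<open>f\<close> from above off the Bohr set;
    \<open>\<rho>'\<close> bounds it from below on the smaller Bohr set of radius
    \<open>e / (2 * r)\<close>. The gap between them is what high powers amplify.\<close>
  define \<rho> where "\<rho> = 1 - e\<^sup>2 / (4 * r)"
  define \<rho>' where "\<rho>' = 1 - e\<^sup>2 / (16 * r)"
  have "e\<^sup>2 \<le> 1" using e by (simp add: power_le_one)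
  then have \<rho>: "0 \<le> \<rho>" "\<rho> < \<rho>'" using e r by (auto simp: \<rho>_def \<rho>'_def field_simps)
  have off: "f k \<le> \<rho>" if "k \<notin> bohr_set F e" for k
  proof -
    obtain z where z: "z \<in> F" "cmod (z ^ k - 1) > e" using \<open>k \<notin> _\<close> by (force simp: bohr_set_def)
    have "e\<^sup>2 \<le> (cmod (z ^ k - 1))\<^sup>2" using z e by (intro power_mono) auto
    also have "\<dots> \<le> (\<Sum>z\<in>F. (cmod (z ^ k - 1))\<^sup>2)"
      using z F by (intro member_le_sum) auto
    finally show ?thesis using r by (auto simp: f_eq \<rho>_def intro!: divide_right_mono)
  qed
  have on: "f k \<ge> \<rho>'" if "k \<in> bohr_set F (e / (2 * r))" for k
  proof -
    have "(\<Sum>z\<in>F. (cmod (z ^ k - 1))\<^sup>2) \<le> (\<Sum>z\<in>F. (e / (2 * r))\<^sup>2)"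
      using that by (intro sum_mono power_mono) (auto simp: bohr_set_def)
    also have "\<dots> = e\<^sup>2 / (4 * r)" using r by (simp add: r_def[symmetric] power2_eq_square)
    also have "\<dots> \<le> e\<^sup>2 / 4" using r by (intro divide_left_mono) auto
    finally have "(\<Sum>z\<in>F. (cmod (z ^ k - 1))\<^sup>2) / (4 * r) \<le> e\<^sup>2 / 4 / (4 * r)"
      using r by (intro divide_right_mono) auto
    then show ?thesis by (simp add: f_eq \<rho>'_def)
  qed
  have "e / (2 * r) \<le> e / 1" using r e by (intro divide_left_mono) auto
  then have sub: "bohr_set F (e / (2 * r)) \<subseteq> bohr_set F e"
    by (auto simp: bohr_set_def intro: order_trans)
  obtain L where L: "\<And>k. \<exists>b\<in>bohr_set F (e / (2 * r)). k < b \<and> b < k + L"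
    using bohr_set_syndetic[of F "e / (2 * r)"] F(1) subsetD[OF F(2)] unit e(1) r by auto
  then have Lpos: "L > 0" by (metis add_0_right gr0I less_asym)
  \<comment> \<open>\<open>M\<close> is so large that one good term in a window of length
    \<open>L\<close> outweighs up to \<open>L\<close> bad terms, each at least
    \<open>- (\<rho> ^ M)\<close>.\<close>
  obtain M where "(\<rho> / \<rho>') ^ M < 1 / (2 * real L)"
    using real_arch_pow_inv[of "1 / (2 * real L)" "\<rho> / \<rho>'"] \<rho> Lpos by auto
  then have M: "real L * \<rho> ^ M < \<rho>' ^ M / 2"
    using \<rho> Lpos by (simp add: power_divide field_simps)
  define g where "g k = f k ^ M * Re (w ^ k)" for k
  define \<eta> where "\<eta> = \<rho>' ^ M / 2 - real L * \<rho> ^ M"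
  have "\<eta> > 0" using M by (simp add: \<eta>_def)
  have Rew: "Re (w ^ k) \<ge> 1/2" if "k \<in> bohr_set F e" for k
  proof -
    have "cmod (w ^ k - 1) \<le> 1/2" using wp that by (simp add: power_polar_def)
    then have "(cmod (w ^ k - 1))\<^sup>2 \<le> (1/2)\<^sup>2" by (intro power_mono) auto
    then show ?thesis using cmod_diff_one_sq[of "w ^ k"] w1 by (simp add: norm_power power2_eq_square)
  qed
  have g_ge: "g k \<ge> - (\<rho> ^ M)" for k
  proof (cases "k \<in> bohr_set F e")
    case True
    then have "g k \<ge> 0" using Rew[of k] f0 by (simp add: g_def)
    then show ?thesis using \<rho> by (smt (verit) zero_le_power)
  next
    case False
    have "\<bar>Re (w ^ k)\<bar> \<le> 1" using abs_Re_le_cmod[of "w ^ k"] w1 by (simp add: norm_power)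
    then have "\<bar>g k\<bar> \<le> f k ^ M * 1"
      unfolding g_def abs_mult using f0 by (intro mult_mono) auto
    also have "\<dots> \<le> \<rho> ^ M" using power_mono[OF off[OF False] f0] by simp
    finally show ?thesis by simp
  qed
  have block: "\<eta> \<le> sum g {q * L..<q * L + L}" for q
  proof -
    obtain b where b: "b \<in> bohr_set F (e / (2 * r))" "q * L < b" "b < q * L + L" using L by blast
    have "\<rho>' ^ M * (1/2) \<le> g b" unfolding g_def
    proof (intro mult_mono power_mono)
      show "\<rho>' \<le> f b" using on b by blast
      show "1/2 \<le> Re (w ^ b)" using Rew b sub by blast
    qed (use \<rho> f0 in auto)
    moreover have "- (real L * \<rho> ^ M) \<le> sum g ({q * L..<q * L + L} - {b})"
    proof -
      have "- (real L * \<rho> ^ M) \<le> (\<Sum>k\<in>{q * L..<q * L + L} - {b}. - (\<rho> ^ M))"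
        using b \<rho> by (simp add: mult_right_mono)
      also have "\<dots> \<le> sum g ({q * L..<q * L + L} - {b})" by (intro sum_mono g_ge)
      finally show ?thesis .
    qed
    ultimately show ?thesis using b by (simp add: \<eta>_def sum.remove[of _ b])
  qed
  have linear: "real q * \<eta> \<le> sum g {..<q * L}" for q
  proof -
    have "real q * \<eta> \<le> (\<Sum>i<q. sum g {i * L..<i * L + L})"
      using sum_mono[of "{..<q}" "\<lambda>_. \<eta>"] block by simp
    then show ?thesis by (simp add: sum.nat_group)
  qed
  obtain C where C: "\<And>N. cmod (\<Sum>k<N. of_real (f k) ^ M * w ^ k) \<le> C"
    using bounded_weighted_power_sums[OF Z unit F(1,2) w1 wZ, of M] unfolding f_def r_def by auto
  obtain q where "real q * \<eta> > C" using reals_Archimedean3[OF \<open>\<eta> > 0\<close>] by blast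
  moreover have "sum g {..<q * L} = Re (\<Sum>k<q * L. of_real (f k) ^ M * w ^ k)"
    by (simp add: g_def flip: of_real_power)
  ultimately show False
    using linear[of q] C[of "q * L"] complex_Re_le_cmod[of "\<Sum>k<q * L. of_real (f k) ^ M * w ^ k"] by simp
qed

section \<open>Compactness of polars\<close>

lemma closed_power_polar: "closed (power_polar A)"
proof -
  have "power_polar A = sphere 0 1 \<inter> (\<Inter>k\<in>A. {w. cmod (w ^ k - 1) \<le> 1/2})"
    by (auto simp: power_polar_def)
  then show ?thesis
    by (auto intro!: closed_Int closed_INT closed_Collect_le continuous_intros)
qed

lemma power_polar_finite_subset:
  assumes "closed C" "power_polar B \<inter> C = {}"
  shows "\<exists>A. finite A \<and> A \<subseteq> B \<and> power_polar A \<inter> C = {}"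
proof (rule ccontr)
  assume *: "\<nexists>A. finite A \<and> A \<subseteq> B \<and> power_polar A \<inter> C = {}"
  \<comment> \<open>The explicit sphere keeps this identity true for empty \<open>A\<close>.\<close>
  have eq: "sphere 0 1 \<inter> C \<inter> (\<Inter>k\<in>A. power_polar {k}) = power_polar A \<inter> C" for A
    by (auto simp: power_polar_def)
  have "sphere 0 1 \<inter> C \<inter> (\<Inter>k\<in>B. power_polar {k}) \<noteq> {}"
  proof (rule compact_imp_fip_image)
    show "compact (sphere 0 1 \<inter> C)" using assms(1) by (simp add: compact_Int_closed)
    show "sphere 0 1 \<inter> C \<inter> (\<Inter>k\<in>A. power_polar {k}) \<noteq> {}" if "finite A" "A \<subseteq> B" for A
      unfolding eq using * that by blast
  qed (rule closed_power_polar)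
  then show False using assms(2) unfolding eq by simp
qed

section \<open>Finite blocks in the Bohr sets of a countable subgroup\<close>

locale countable_circle_subgroup =
  fixes Z :: "complex set"
  assumes one: "1 \<in> Z"
    and mult: "\<And>x y. x \<in> Z \<Longrightarrow> y \<in> Z \<Longrightarrow> x * y \<in> Z"
    and inv: "\<And>x. x \<in> Z \<Longrightarrow> inverse x \<in> Z"
    and unit: "\<And>x. x \<in> Z \<Longrightarrow> cmod x = 1"
    and cnt: "countable Z"
begin

text \<open>One index governs both the finite set of test points and the radius, so the sets
  decrease and each point of \<open>Z\<close> is eventually tested to any accuracy. For finite
  \<open>Z\<close> the enumeration merely repeats elements.\<close>

definition B :: "nat \<Rightarrow> nat set" where
  "B n = bohr_set (from_nat_into Z ` {..n}) (1 / Suc n)"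

definition K :: "nat \<Rightarrow> complex set" where
  "K n = power_polar (B n)"

lemma generators: "from_nat_into Z ` {..n} \<subseteq> Z"
  using from_nat_into[of Z] one by blast

lemma B_unbounded: "\<exists>b\<in>B n. k < b"
proof -
  have "\<exists>L. \<forall>k. \<exists>b\<in>B n. k < b \<and> b < k + L"
    unfolding B_def by (intro bohr_set_syndetic) (use generators[of n] unit in auto)
  then show ?thesis by blast
qed

lemma B_decseq: "m \<le> n \<Longrightarrow> B n \<subseteq> B m"
proof
  fix k assume "m \<le> n" "k \<in> B n"
  then have "cmod (from_nat_into Z i ^ k - 1) \<le> 1 / real (Suc n)" if "i \<le> m" for i
    using that by (auto simp: B_def bohr_set_def)
  moreover have "1 / real (Suc n) \<le> 1 / real (Suc m)" using \<open>m \<le> n\<close> by (simp add: frac_le)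
  ultimately show "k \<in> B m" by (auto simp: B_def bohr_set_def intro: order_trans)
qed

lemma K_incseq: "m \<le> n \<Longrightarrow> K m \<subseteq> K n"
  using B_decseq[of m n] by (auto simp: K_def power_polar_def)

lemma K_subset: "K n \<subseteq> Z"
  unfolding K_def B_def
  by (intro power_polar_bohr_set_subset one mult inv unit generators) auto

lemma finite_K: "finite (K n)"
  unfolding K_def B_def
  by (intro finite_power_polar_bohr_set) (use generators[of n] unit in auto)

lemma K_separated: "\<exists>d>0. \<forall>x\<in>K n. \<forall>y\<in>K n. dist x y < d \<longrightarrow> x = y"
  unfolding K_def B_def
  by (intro power_polar_bohr_set_separated) (use generators[of n] unit in auto)

lemma tendsto_one_if_eventually_B:
  assumes "\<And>n. eventually (\<lambda>j. a j \<in> B n) sequentially" and "z \<in> Z"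
  shows "(\<lambda>j. z ^ a j) \<longlonglongrightarrow> 1"
proof (rule tendstoI)
  fix e :: real assume "e > 0"
  obtain i where i: "z = from_nat_into Z i"
    using from_nat_into_surj[OF cnt assms(2)] by metis
  obtain n where n: "1 / real (Suc n) < e" using nat_approx_posE[OF \<open>e > 0\<close>] by blast
  have "eventually (\<lambda>j. a j \<in> B (max i n)) sequentially" by (rule assms)
  then show "eventually (\<lambda>j. dist (z ^ a j) 1 < e) sequentially"
  proof eventually_elim
    case (elim j)
    then have "dist (z ^ a j) 1 \<le> 1 / real (Suc (max i n))"
      by (auto simp: B_def bohr_set_def dist_norm i)
    also have "\<dots> \<le> 1 / real (Suc n)" by (intro divide_left_mono) auto
    finally show ?case using n by simp
  qed
qed

text \<open>\<open>A'\<close> keeps the points of \<open>K (Suc n)\<close> that are new relative to \<open>K n\<close> at distance \<open>d\<close> from the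
  polar, and \<open>A''\<close> confines the polar to the \<open>d\<close>-neighbourhood of \<open>K (Suc n)\<close>.\<close>

lemma exists_blocks:
  "\<exists>A' A'' d. finite A' \<and> A' \<subseteq> B n \<and> finite A'' \<and> A'' \<subseteq> B (Suc n) \<and> 0 < d \<and> d \<le> 1 / real (Suc n) \<and>
     (\<forall>x\<in>K (Suc n). \<forall>y\<in>K (Suc n). dist x y < 2 * d \<longrightarrow> x = y) \<and>
     (\<forall>w\<in>power_polar A'. \<forall>x\<in>K (Suc n). dist x w < d \<longrightarrow> x \<in> K n) \<and>
     (\<forall>w\<in>power_polar A''. \<exists>x\<in>K (Suc n). dist x w < d)"
proof -
  have "closed (K (Suc n) - K n)" using finite_K by (simp add: finite_imp_closed)
  then obtain A' where A': "finite A'" "A' \<subseteq> B n" "power_polar A' \<inter> (K (Suc n) - K n) = {}"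
    using power_polar_finite_subset[of "K (Suc n) - K n" "B n"] by (auto simp: K_def)
  obtain d1 where d1: "d1 > 0" "\<And>x y. x \<in> K (Suc n) \<Longrightarrow> y \<in> K (Suc n) \<Longrightarrow> dist x y < d1 \<Longrightarrow> x = y"
    using K_separated[of "Suc n"] by blast
  have "compact (K (Suc n) - K n)" using finite_K by (simp add: finite_imp_compact)
  then obtain d2 where d2: "d2 > 0" "\<And>x w. x \<in> K (Suc n) - K n \<Longrightarrow> w \<in> power_polar A' \<Longrightarrow> d2 \<le> dist x w"
    using separate_compact_closed[of "K (Suc n) - K n" "power_polar A'"] closed_power_polar A'(3) by blast
  \<comment> \<open>The three terms make \<open>d\<close> tend to 0 with \<open>n\<close>, keep
    distinct points of \<open>K (Suc n)\<close> at least \<open>2 * d\<close> apart, and keep the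
    new points at distance at least \<open>d\<close> from the polar of \<open>A'\<close>.\<close>
  define d where "d = min (1 / real (Suc n)) (min (d1 / 2) d2)"
  have d: "d > 0" "d \<le> 1 / real (Suc n)" "2 * d \<le> d1" "d \<le> d2" using d1 d2 by (auto simp: d_def)
  have "closed (- (\<Union>x\<in>K (Suc n). ball x d))" by (intro closed_Compl open_UN) auto
  moreover have "power_polar (B (Suc n)) \<inter> - (\<Union>x\<in>K (Suc n). ball x d) = {}"
    using d(1) centre_in_ball unfolding K_def by blast
  ultimately obtain A'' where A'': "finite A''" "A'' \<subseteq> B (Suc n)"
    "power_polar A'' \<inter> - (\<Union>x\<in>K (Suc n). ball x d) = {}"
    using power_polar_finite_subset[of "- (\<Union>x\<in>K (Suc n). ball x d)" "B (Suc n)"] by blast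
  have "\<exists>x\<in>K (Suc n). dist x w < d" if "w \<in> power_polar A''" for w
    using A''(3) that by auto
  moreover have "x \<in> K n" if "w \<in> power_polar A'" "x \<in> K (Suc n)" "dist x w < d" for w x
    using d2(2)[of x w] that d(4) by force
  moreover have "x = y" if "x \<in> K (Suc n)" "y \<in> K (Suc n)" "dist x y < 2 * d" for x y
    using d1(2) that d(3) by force
  ultimately show ?thesis using A'(1,2) A''(1,2) d(1,2)
    by (intro exI[of _ A'] exI[of _ A''] exI[of _ d] conjI ballI impI) simp_all
qed

text \<open>For each late \<open>n\<close>, \<open>A''\<close> puts \<open>w\<close> within
  \<open>d n\<close> of some \<open>x n\<close> in \<open>K (Suc n)\<close>, and \<open>A'\<close>
  at the next level pulls \<open>x (Suc n)\<close> back into \<open>K (Suc n)\<close>. Separation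
  then gives \<open>x (Suc n) = x n\<close>, and as \<open>d n\<close> tends to 0, \<open>w\<close>
  equals this constant point, which lies in \<open>Z\<close>.\<close>

lemma exists_characterizing_blocks:
  "\<exists>A. (\<forall>n. finite (A n) \<and> A n \<subseteq> B n) \<and>
     (\<forall>w n0. (\<forall>n\<ge>n0. w \<in> power_polar (A n)) \<longrightarrow> w \<in> Z)"
proof -
  obtain A' A'' d where A': "\<And>n. finite (A' n)" "\<And>n. A' n \<subseteq> B n"
    and A'': "\<And>n. finite (A'' n)" "\<And>n. A'' n \<subseteq> B (Suc n)"
    and d: "\<And>n. d n \<le> 1 / real (Suc n)"
    and sep: "\<And>n x y. x \<in> K (Suc n) \<Longrightarrow> y \<in> K (Suc n) \<Longrightarrow> dist x y < 2 * d n \<Longrightarrow> x = y"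
    and old: "\<And>n x w. w \<in> power_polar (A' n) \<Longrightarrow> x \<in> K (Suc n) \<Longrightarrow> dist x w < d n \<Longrightarrow> x \<in> K n"
    and near: "\<And>n w. w \<in> power_polar (A'' n) \<Longrightarrow> \<exists>x\<in>K (Suc n). dist x w < d n"
    using exists_blocks by metis
  define A where "A n = A' n \<union> A'' n" for n
  have "A n \<subseteq> B n" for n using A'(2) A''(2) B_decseq[of n "Suc n"] by (fastforce simp: A_def)
  moreover have "w \<in> Z" if w: "\<And>n. n \<ge> n0 \<Longrightarrow> w \<in> power_polar (A n)" for w n0
  proof -
    have w': "w \<in> power_polar (A' n)" "w \<in> power_polar (A'' n)" if "n \<ge> n0" for n
      using w[OF that] by (auto simp: A_def power_polar_def)
    have "\<forall>n. \<exists>x. n \<ge> n0 \<longrightarrow> x \<in> K (Suc n) \<and> dist x w < d n" using near w' by blast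
    then obtain x where x: "\<And>n. n \<ge> n0 \<Longrightarrow> x n \<in> K (Suc n)" "\<And>n. n \<ge> n0 \<Longrightarrow> dist (x n) w < d n"
      by metis
    have step: "x (Suc n) = x n" if "n \<ge> n0" for n
    proof -
      have 1: "x (Suc n) \<in> K (Suc n)" using old[of w "Suc n" "x (Suc n)"] w' x that by simp
      have 2: "x n \<in> K (Suc (Suc n))" using x(1)[OF that] K_incseq[of "Suc n" "Suc (Suc n)"] by auto
      have 3: "dist (x (Suc n)) (x n) < d n + d (Suc n)"
        using x(2)[of n] x(2)[of "Suc n"] that dist_triangle2[of "x (Suc n)" "x n" w] by simp
      \<comment> \<open>The distance is below twice the larger of \<open>d n\<close> and
        \<open>d (Suc n)\<close>; both points lie in the \<open>K\<close> of either level, so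
        separation is used at the level of the larger one.\<close>
      show ?thesis
      proof (cases "d n \<le> d (Suc n)")
        case True
        then show ?thesis using 2 3 x(1)[of "Suc n"] that sep[of "x (Suc n)" "Suc n" "x n"] by simp
      next
        case False
        then show ?thesis using 1 3 x(1)[of n] that sep[of "x (Suc n)" n "x n"] by simp
      qed
    qed
    have const: "x n = x n0" if "n \<ge> n0" for n
      using that by (induction n rule: dec_induct) (auto simp: step)
    have "dist (x n0) w \<le> e" if e: "e > 0" for e
    proof -
      obtain n where n: "1 / real (Suc n) < e" using nat_approx_posE[OF e] by blast
      define m where "m = max n n0"
      have "dist (x n0) w \<le> 1 / real (Suc m)"
        using const[of m] x(2)[of m] d[of m] by (simp add: m_def)
      also have "\<dots> \<le> 1 / real (Suc n)" by (intro divide_left_mono) (auto simp: m_def)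
      finally show ?thesis using n by simp
    qed
    then have "dist (x n0) w \<le> 0" by (rule field_le_epsilon) simp
    then show ?thesis using x(1)[of n0] K_subset by auto
  qed
  moreover have "finite (A n)" for n using A'(1) A''(1) by (simp add: A_def)
  ultimately show ?thesis by (intro exI[of _ A]) blast
qed

section \<open>From blocks to a characterizing sequence\<close>

lemma exists_characterizing_powers:
  "\<exists>a. (\<forall>j. a j > 0) \<and> (\<forall>w. cmod w = 1 \<longrightarrow> w \<in> Z \<longleftrightarrow> (\<lambda>j. w ^ a j) \<longlonglongrightarrow> 1)"
proof -
  obtain A where A: "\<And>n. finite (A n)" "\<And>n. A n \<subseteq> B n"
    and A_Z: "\<And>w n0. (\<And>n. n \<ge> n0 \<Longrightarrow> w \<in> power_polar (A n)) \<Longrightarrow> w \<in> Z"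
    using exists_characterizing_blocks by metis
  obtain b where b: "\<And>n. b n \<in> B n" "\<And>n. 0 < b n"
    using B_unbounded[where k = 0] by metis
  \<comment> \<open>Tagging exponents with their block index leaves only finitely many terms of
    index below \<open>n\<close>. The extra \<open>b n\<close> makes \<open>P\<close> infinite even
    if the blocks are empty; dropping 0 is harmless since \<open>w ^ 0 = 1\<close>.\<close>
  define P where "P = Sigma UNIV (\<lambda>n. insert (b n) (A n - {0}))"
  have "range (\<lambda>n. (n, b n)) \<subseteq> P" by (auto simp: P_def)
  moreover have "infinite (range (\<lambda>n. (n, b n)))"
    by (intro range_inj_infinite) (auto simp: inj_def)
  ultimately have inf: "infinite P" using finite_subset by blast
  define s where "s = from_nat_into P"
  have s: "bij_betw s UNIV P"
    unfolding s_def by (intro bij_betw_from_nat_into inf) simp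
  have sP: "s j \<in> P" for j using bij_betwE[OF s] by blast
  have small: "finite {j. fst (s j) < n}" for n
  proof -
    have "s j \<in> Sigma {..<n} (\<lambda>n. insert (b n) (A n))" if "fst (s j) < n" for j
      using sP[of j] that by (cases "s j") (auto simp: P_def)
    then have "s ` {j. fst (s j) < n} \<subseteq> Sigma {..<n} (\<lambda>n. insert (b n) (A n))" by blast
    moreover have "finite (Sigma {..<n} (\<lambda>n. insert (b n) (A n)))" using A(1) by auto
    ultimately have "finite (s ` {j. fst (s j) < n})" using finite_subset by blast
    then show ?thesis
      using finite_imageD inj_on_subset[OF bij_betw_imp_inj_on[OF s]] by blast
  qed
  define a where "a j = snd (s j)" for j
  have aB: "a j \<in> B (fst (s j))" "a j > 0" for j
    using sP[of j] subsetD[OF A(2)] b by (auto simp: P_def a_def mem_Sigma_iff split: prod.splits)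
  have "w \<in> Z" if w: "cmod w = 1" and lim: "(\<lambda>j. w ^ a j) \<longlonglongrightarrow> 1" for w
  proof -
    have "eventually (\<lambda>j. dist (w ^ a j) 1 < 1/2) sequentially"
      using tendstoD[OF lim, of "1/2"] by simp
    then obtain J where J: "\<And>j. j \<ge> J \<Longrightarrow> cmod (w ^ a j - 1) < 1/2"
      by (auto simp: eventually_sequentially dist_norm)
    \<comment> \<open>Blocks from \<open>n0\<close> on are enumerated only at positions
      \<open>J\<close> or later. The inserted 0 keeps \<open>Max\<close> meaningful for
      \<open>J = 0\<close>.\<close>
    define n0 where "n0 = Suc (Max (insert 0 ((fst \<circ> s) ` {..<J})))"
    have n0: "fst (s j) < n0" if "j < J" for j
      using that unfolding n0_def less_Suc_eq_le by (intro Max_ge) auto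
    have "w \<in> power_polar (A n)" if "n \<ge> n0" for n
    proof -
      have "cmod (w ^ k - 1) \<le> 1/2" if k: "k \<in> A n" for k
      proof (cases "k = 0")
        case False
        then have "(n, k) \<in> P" using k by (simp add: P_def)
        then obtain j where j: "s j = (n, k)" using s by (metis bij_betw_imp_surj_on imageE)
        then have "J \<le> j" using n0[of j] \<open>n \<ge> n0\<close> by force
        then show ?thesis using J[of j] j by (simp add: a_def)
      qed simp
      then show ?thesis using w by (simp add: power_polar_def)
    qed
    then show ?thesis by (rule A_Z)
  qed
  moreover have "(\<lambda>j. z ^ a j) \<longlonglongrightarrow> 1" if "z \<in> Z" for z
  proof (rule tendsto_one_if_eventually_B[OF _ that])
    fix n
    have "eventually (\<lambda>j. j \<notin> {j. fst (s j) < n}) sequentially"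
      using small[of n] unfolding cofinite_eq_sequentially[symmetric] eventually_cofinite by simp
    then show "eventually (\<lambda>j. a j \<in> B n) sequentially"
    proof eventually_elim
      case (elim j)
      then have "B (fst (s j)) \<subseteq> B n" by (intro B_decseq) simp
      then show ?case using aB(1) by blast
    qed
  qed
  ultimately show ?thesis using aB(2) by (intro exI[of _ a]) blast
qed

section \<open>Growth beyond a prescribed sequence\<close>

lemma exists_fast_shifts:
  "\<exists>N. (\<forall>j. p j < N j \<and> N j + a j < N (Suc j)) \<and> (\<forall>z\<in>Z. (\<lambda>j. z ^ N j) \<longlonglongrightarrow> 1)"
proof -
  have "\<exists>N. \<forall>j. (N j \<in> B j \<and> p j < N j) \<and> N j + a j < N (Suc j)"
  proof (rule dependent_nat_choice)
    show "\<exists>x. x \<in> B 0 \<and> p 0 < x" using B_unbounded by blast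
    show "\<exists>y. (y \<in> B (Suc n) \<and> p (Suc n) < y) \<and> x + a n < y" for x n
      using B_unbounded[of "Suc n" "max (p (Suc n)) (x + a n)"] by auto
  qed
  then obtain N where N: "\<And>j. N j \<in> B j" "\<And>j. p j < N j" "\<And>j. N j + a j < N (Suc j)" by blast
  have "(\<lambda>j. z ^ N j) \<longlonglongrightarrow> 1" if "z \<in> Z" for z
  proof (rule tendsto_one_if_eventually_B[OF _ that])
    show "eventually (\<lambda>j. N j \<in> B n) sequentially" for n
      using eventually_ge_at_top[of n] by eventually_elim (use N(1) B_decseq in blast)
  qed
  then show ?thesis using N by blast
qed

text \<open>\<open>w ^ N \<rightarrow> 1\<close> and \<open>w ^ (N + a) \<rightarrow> 1\<close> together force \<open>w ^ a \<rightarrow> 1\<close>, so adding fast shifts to a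
  slow characterizing sequence loses nothing.\<close>

lemma exists_fast_characterizing_powers:
  fixes m :: "nat \<Rightarrow> nat"
  assumes m: "\<And>n. 1 \<le> n \<Longrightarrow> m n < m (Suc n)"
  shows "\<exists>k. (\<forall>n\<ge>1. m n < k n \<and> k n < k (Suc n)) \<and>
     (\<forall>w. cmod w = 1 \<longrightarrow> w \<in> Z \<longleftrightarrow> (\<lambda>n. w ^ k n) \<longlonglongrightarrow> 1)"
proof -
  obtain a where a: "\<And>j. a j > 0" "\<And>w. cmod w = 1 \<Longrightarrow> w \<in> Z \<longleftrightarrow> (\<lambda>j. w ^ a j) \<longlonglongrightarrow> 1"
    using exists_characterizing_powers by blast
  \<comment> \<open>Bounding \<open>N j\<close> by \<open>m\<close> at the later position
    \<open>2 * j + 2\<close> also covers position \<open>2 * j + 1\<close>, as \<open>m\<close>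
    increases.\<close>
  obtain N where N: "\<And>j. m (2 * j + 2) < N j" "\<And>j. N j + a j < N (Suc j)"
    and limN: "\<And>z. z \<in> Z \<Longrightarrow> (\<lambda>j. z ^ N j) \<longlonglongrightarrow> 1"
    using exists_fast_shifts[of "\<lambda>j. m (2 * j + 2)" a] by blast
  \<comment> \<open>Positions \<open>2 * j + 1\<close> and \<open>2 * j + 2\<close> carry
    \<open>N j\<close> and \<open>N j + a j\<close>; the value at 0 is irrelevant.\<close>
  define k where "k n = (let j = (n - 1) div 2 in N j + (if odd n then 0 else a j))" for n
  have k: "k (2 * j + 1) = N j" "k (2 * j + 2) = N j + a j" for j
    by (auto simp: k_def Let_def)
  have cases: "P n" if "n \<ge> 1" "\<And>j. P (2 * j + 1)" "\<And>j. P (2 * j + 2)" for n :: nat and P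
  proof (cases "odd n")
    case True
    then show ?thesis using that(2) by (auto elim: oddE)
  next
    case False
    then obtain i where i: "n = 2 * i" by (auto elim: evenE)
    then show ?thesis using that(1) that(3)[of "i - 1"] by (cases i) auto
  qed
  have "m n < k n \<and> k n < k (Suc n)" if "n \<ge> 1" for n
  proof (rule cases[OF that])
    fix j
    show "m (2 * j + 1) < k (2 * j + 1) \<and> k (2 * j + 1) < k (Suc (2 * j + 1))"
      using N(1)[of j] m[of "2 * j + 1"] a(1)[of j] k[of j] by simp
    show "m (2 * j + 2) < k (2 * j + 2) \<and> k (2 * j + 2) < k (Suc (2 * j + 2))"
      using N(1)[of j] N(2)[of j] k[of j] k(1)[of "Suc j"] by simp
  qed
  moreover have "w \<in> Z" if w: "cmod w = 1" and lim: "(\<lambda>n. w ^ k n) \<longlonglongrightarrow> 1" for w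
  proof -
    have "(\<lambda>j. w ^ k (2 * j + 1)) \<longlonglongrightarrow> 1" "(\<lambda>j. w ^ k (2 * j + 2)) \<longlonglongrightarrow> 1"
      by (rule LIMSEQ_subseq_LIMSEQ[OF lim, unfolded o_def]; simp add: strict_mono_def)+
    then have "(\<lambda>j. w ^ k (2 * j + 2) / w ^ k (2 * j + 1)) \<longlonglongrightarrow> 1 / 1"
      by (intro tendsto_divide) auto
    moreover have "w \<noteq> 0" using w by auto
    ultimately have "(\<lambda>j. w ^ a j) \<longlonglongrightarrow> 1" by (simp only: k power_add) simp
    then show ?thesis using a(2) w by blast
  qed
  moreover have "(\<lambda>n. z ^ k n) \<longlonglongrightarrow> 1" if z: "z \<in> Z" for z
  proof -
    have "(\<lambda>j. z ^ a j) \<longlonglongrightarrow> 1" using a(2)[OF unit[OF z]] z by blast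
    then have lim2: "(\<lambda>j. z ^ N j * z ^ a j) \<longlonglongrightarrow> 1 * 1" by (intro tendsto_mult limN z)
    show ?thesis
    proof (rule tendstoI)
      fix e :: real assume "e > 0"
      then obtain J1 J2 where J: "\<And>j. j \<ge> J1 \<Longrightarrow> dist (z ^ N j) 1 < e"
        "\<And>j. j \<ge> J2 \<Longrightarrow> dist (z ^ N j * z ^ a j) 1 < e"
        using tendstoD[OF limN[OF z]] tendstoD[OF lim2] unfolding eventually_sequentially by fastforce
      have "dist (z ^ k n) 1 < e" if "n \<ge> 2 * max J1 J2 + 1" for n
      proof -
        have "J1 \<le> (n - 1) div 2" "J2 \<le> (n - 1) div 2" using that by auto
        then show ?thesis using J by (auto simp: k_def Let_def power_add)
      qed
      then show "eventually (\<lambda>n. dist (z ^ k n) 1 < e) sequentially"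
        unfolding eventually_sequentially by blast
    qed
  qed
  ultimately show ?thesis by blast
qed

end

section \<open>Transfer to the quotient group\<close>

lift_definition circle_to_complex :: "circle \<Rightarrow> complex" is "\<lambda>x. cis (2 * pi * x)"
proof -
  fix x y :: real assume "x - y \<in> \<int>"
  then have "cis (2 * pi * (x - y)) = 1" by simp
  then show "cis (2 * pi * x) = cis (2 * pi * y)"
    by (simp add: right_diff_distrib flip: cis_divide)
qed

lemma norm_circle_to_complex [simp]: "cmod (circle_to_complex a) = 1"
  by transfer simp

lemma circle_to_complex_zero [simp]: "circle_to_complex 0 = 1"
  by transfer simp

lemma circle_to_complex_add: "circle_to_complex (a + b) = circle_to_complex a * circle_to_complex b"
  by transfer (simp add: cis_mult distrib_left)

lemma circle_to_complex_minus: "circle_to_complex (- a) = inverse (circle_to_complex a)"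
  by transfer simp

lemma circle_to_complex_int_mult:
  "circle_to_complex (int_mult (int n) a) = circle_to_complex a ^ n"
  by transfer (simp add: Complex.DeMoivre mult_ac)

lemma inj_circle_to_complex: "inj circle_to_complex"
proof (rule injI)
  fix a b :: circle
  show "circle_to_complex a = circle_to_complex b \<Longrightarrow> a = b"
  proof transfer
    fix x y :: real
    assume "cis (2 * pi * x) = cis (2 * pi * y)"
    then have "cis (2 * pi * (x - y)) = 1"
      by (simp add: right_diff_distrib flip: cis_divide)
    then obtain n where "2 * pi * (x - y) = of_int n * (2 * pi)" using cis_eq_1_iff by blast
    then have "x - y = of_int n" by simp
    then show "x - y \<in> \<int>" by simp
  qed
qed

text \<open>Forwards, the embedding is continuous for the quotient topology. Backwards,
  \<open>Arg\<close> is continuous at 1, so \<open>Arg / (2 * pi)\<close> gives real representatives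
  of the \<open>X i\<close> that tend to 0.\<close>

lemma tendsto_zero_circle_iff:
  "(X \<longlongrightarrow> 0) F \<longleftrightarrow> ((\<lambda>i. circle_to_complex (X i)) \<longlongrightarrow> 1) F"
proof
  assume X: "(X \<longlongrightarrow> 0) F"
  show "((\<lambda>i. circle_to_complex (X i)) \<longlongrightarrow> 1) F"
  proof (rule topological_tendstoI)
    fix S :: "complex set" assume S: "open S" "1 \<in> S"
    have "circle_of_real -` (circle_to_complex -` S) = (\<lambda>x. cis (2 * pi * x)) -` S"
      by (auto simp: circle_to_complex.abs_eq)
    moreover have "open \<dots>" using S(1) by (intro open_vimage continuous_intros)
    ultimately have "open (circle_to_complex -` S)" by (simp add: open_circle_def)
    then show "eventually (\<lambda>i. circle_to_complex (X i) \<in> S) F"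
      using topological_tendstoD[OF X, of "circle_to_complex -` S"] S(2) by simp
  qed
next
  assume X: "((\<lambda>i. circle_to_complex (X i)) \<longlongrightarrow> 1) F"
  define t where "t i = Arg (circle_to_complex (X i)) / (2 * pi)" for i
  have "isCont Arg 1" by (rule continuous_at_Arg) (simp add: complex_nonpos_Reals_iff)
  then have "(t \<longlongrightarrow> Arg 1 / (2 * pi)) F"
    unfolding t_def by (intro tendsto_divide isCont_tendsto_compose[OF _ X] tendsto_const) auto
  then have t: "(t \<longlongrightarrow> 0) F" by simp
  have Xt: "X i = circle_of_real (t i)" for i
  proof (rule injD[OF inj_circle_to_complex])
    have "circle_to_complex (X i) \<noteq> 0" using norm_circle_to_complex[of "X i"] by force
    then show "circle_to_complex (X i) = circle_to_complex (circle_of_real (t i))"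
      by (simp add: circle_to_complex.abs_eq t_def cis_Arg sgn_div_norm)
  qed
  show "(X \<longlongrightarrow> 0) F"
  proof (rule topological_tendstoI)
    fix S :: "circle set" assume S: "open S" "0 \<in> S"
    then have "open (circle_of_real -` S)" "0 \<in> circle_of_real -` S"
      by (auto simp: open_circle_def zero_circle.abs_eq)
    then show "eventually (\<lambda>i. X i \<in> S) F"
      using topological_tendstoD[OF t, of "circle_of_real -` S"] by (simp add: Xt)
  qed
qed

theorem theorem4p2:
  fixes H :: "circle set" and m :: "nat \<Rightarrow> int"
  assumes "add_subgroup H" and "countable H"
    and "strict_mono_on {1..} m" and "\<And>n. n \<ge> 1 \<Longrightarrow> m n > 0"
  shows "\<exists>k :: nat \<Rightarrow> int. strict_mono_on {1..} k \<and> characterizing k H \<and> (\<forall>n\<ge>1. m n < k n)"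
proof -
  interpret countable_circle_subgroup "circle_to_complex ` H"
  proof
    show "1 \<in> circle_to_complex ` H"
      using assms(1) by (metis add_subgroup_def circle_to_complex_zero imageI)
    show "x * y \<in> circle_to_complex ` H"
      if "x \<in> circle_to_complex ` H" "y \<in> circle_to_complex ` H" for x y
      using that assms(1) by (auto simp: add_subgroup_def simp flip: circle_to_complex_add)
    show "inverse x \<in> circle_to_complex ` H" if "x \<in> circle_to_complex ` H" for x
      using that assms(1) by (auto simp: add_subgroup_def simp flip: circle_to_complex_minus)
  qed (use assms(2) in auto)
  have "nat (m n) < nat (m (Suc n))" if "n \<ge> 1" for n
    using strict_mono_onD[OF assms(3), of n "Suc n"] assms(4)[of "Suc n"] that by simp
  then obtain k where k: "\<And>n. n \<ge> 1 \<Longrightarrow> nat (m n) < k n" "\<And>n. n \<ge> 1 \<Longrightarrow> k n < k (Suc n)"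
    and char: "\<And>w. cmod w = 1 \<Longrightarrow> w \<in> circle_to_complex ` H \<longleftrightarrow> (\<lambda>n. w ^ k n) \<longlonglongrightarrow> 1"
    using exists_fast_characterizing_powers[of "\<lambda>n. nat (m n)"] by blast
  \<comment> \<open>Growth is known only from index 1 on, so the steps are chained upwards from
    \<open>i\<close>.\<close>
  have "k i < k j" if "1 \<le> i" "i < j" for i j
    using that(2)
  proof (induction j)
    case (Suc j)
    then show ?case using k(2)[of j] that(1) by (cases "i = j") auto
  qed simp
  then have "strict_mono_on {1..} (\<lambda>n. int (k n))" by (auto intro!: strict_mono_onI)
  moreover have "characterizing (\<lambda>n. int (k n)) H"
    unfolding characterizing_def
    by (simp add: tendsto_zero_circle_iff circle_to_complex_int_mult inj_image_mem_iff[OF inj_circle_to_complex]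
        flip: char)
  moreover have "\<forall>n\<ge>1. m n < int (k n)" using k(1) by force
  ultimately show ?thesis by blast
qed

end
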